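(* Let $\mathbb{K}$ be an infinite commutative field and let $n\ge3$ be an odd integer. There exists an irreducible $\lambda$-quiddity of size $n$ over $\mathbb{K}$. In particular, $\ell_{\mathbb{K}}=+\infty$.
   Context: For a commutative unitary ring $B$ and $a_1,\dots,a_n\in B$, set $M_n(a_1,\dots,a_n)=\begin{pmatrix}a_n&-1\\1&0\end{pmatrix}\cdots\begin{pmatrix}a_1&-1\\1&0\end{pmatrix}$. An $n$-tuple $(a_1,\dots,a_n)\in B^n$ is a $\lambda$-quiddity (of size $n$) over $B$ if $M_n(a_1,\dots,a_n)=\epsilon\,\mathrm{Id}$ for some $\epsilon\in\{\pm1_B\}$. For $(a_1,\dots,a_n)\in B^n$, $(b_1,\dots,b_m)\in B^m$ define $(a_1,\dots,a_n)\oplus(b_1,\dots,b_m)=(a_1+b_m,a_2,\dots,a_{n-1},a_n+b_1,b_2,\dots,b_{m-1})$. Two $n$-tuples are equivalent ($\sim$) if one is obtained from the other or from its reversal by a cyclic rotation. A $\lambda$-quiddity $(c_1,\dots,c_n)$ with $n\ge3$ is reducible if there exist a $\lambda$-quiddity $(b_1,\dots,b_l)$ and $(a_1,\dots,a_m)\in B^m$ with $m,l\ge3$ and $(c_1,\dots,c_n)\sim(a_1,\dots,a_m)\oplus(b_1,\dots,b_l)$; otherwise it is irreducible ($(0,0)$ is never irreducible). $\ell_B$ is the maximal size of irreducible $\lambda$-quiddities over $B$ if bounded, and $+\infty$ otherwise. *)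

theory Defs
  imports "HOL-Analysis.Analysis" "HOL-Library.Extended_Nat"
begin

text \<open>An \<open>n\<close>-tuple over a commutative ring is a list of length \<open>n\<close>. A matrix over \<open>'a\<close> is given
  by its list of rows.\<close>

definition elem_mat :: "'a::comm_ring_1 \<Rightarrow> 'a^2^2" where
  "elem_mat a = vector [vector [a, -1], vector [1, 0]]"

text \<open>The factor of the first entry stands rightmost:
  \<open>quid_mat [a\<^sub>1, \<dots>, a\<^sub>n] = elem_mat a\<^sub>n ** \<dots> ** elem_mat a\<^sub>1\<close>.\<close>

fun quid_mat :: "'a::comm_ring_1 list \<Rightarrow> 'a^2^2" where
  "quid_mat [] = mat 1"
| "quid_mat (a # as) = quid_mat as ** elem_mat a"

definition lambda_quiddity :: "'a::comm_ring_1 list \<Rightarrow> bool" where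
  "lambda_quiddity c \<longleftrightarrow> (\<exists>\<epsilon>\<in>{1, -1}. quid_mat c = mat \<epsilon>)"

text \<open>\<open>(a\<^sub>1 + b\<^sub>m, a\<^sub>2, \<dots>, a\<^sub>n\<^sub>-\<^sub>1, a\<^sub>n + b\<^sub>1, b\<^sub>2, \<dots>, b\<^sub>m\<^sub>-\<^sub>1)\<close>; meaningful for
  lists of length at least 2.\<close>

definition tuple_oplus :: "'a::comm_ring_1 list \<Rightarrow> 'a list \<Rightarrow> 'a list" where
  "tuple_oplus a b =
     [hd a + last b] @ butlast (tl a) @ [last a + hd b] @ butlast (tl b)"

definition tuple_equiv :: "'a list \<Rightarrow> 'a list \<Rightarrow> bool" where
  "tuple_equiv c d \<longleftrightarrow> (\<exists>k. d = rotate k c \<or> d = rotate k (rev c))"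

definition reducible_quiddity :: "'a::comm_ring_1 list \<Rightarrow> bool" where
  "reducible_quiddity c \<longleftrightarrow> lambda_quiddity c \<and> length c \<ge> 3 \<and>
     (\<exists>a b. length a \<ge> 3 \<and> length b \<ge> 3 \<and> lambda_quiddity b \<and>
        tuple_equiv c (tuple_oplus a b))"

text \<open>Requiring size at least 3 excludes \<open>(0, 0)\<close> (and the empty list).\<close>

definition irreducible_quiddity :: "'a::comm_ring_1 list \<Rightarrow> bool" where
  "irreducible_quiddity c \<longleftrightarrow>
     lambda_quiddity c \<and> length c \<ge> 3 \<and> \<not> reducible_quiddity c"

text \<open>The set of sizes is never empty: \<open>(1, 1, 1)\<close> is irreducible over every ring.\<close>

definition ell :: "'a::comm_ring_1 itself \<Rightarrow> enat" where
  "ell _ = (let S = {length c | c :: 'a list. irreducible_quiddity c}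
            in if bdd_above S then enat (Max S) else \<infinity>)"

end

theory Submission
  imports Defs
begin

text \<open>Vectors \<open>v\<^sub>i\<close> of the plane with period \<open>n\<close> and \<open>det (v\<^sub>i, v\<^sub>i\<^sub>+\<^sub>1) = 1\<close> satisfy
  \<open>v\<^sub>i\<^sub>+\<^sub>2 = c\<^sub>i v\<^sub>i\<^sub>+\<^sub>1 - v\<^sub>i\<close> with \<open>c\<^sub>i = det (v\<^sub>i, v\<^sub>i\<^sub>+\<^sub>2)\<close>, so \<open>(c\<^sub>0, \<dots>, c\<^sub>n\<^sub>-\<^sub>1)\<close> is a quiddity.
  A reduction of it yields a cyclic window whose continuant is \<open>\<plusminus>1\<close>, and the continuant of a
  window is \<open>det (v\<^sub>i, v\<^sub>j)\<close> with \<open>i\<close>, \<open>j\<close> not cyclically adjacent. Over an infinite field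
  such a polygon with \<open>det (v\<^sub>i, v\<^sub>j) \<noteq> \<plusminus>1\<close> for all non-adjacent \<open>i\<close>, \<open>j\<close> is built greedily:
  each new vector \<open>a v\<^sub>m - v\<^sub>m\<^sub>-\<^sub>1\<close> has to avoid finitely many zeros of nonconstant affine functions of
  \<open>a\<close>, and the last one, \<open>(v\<^sub>0 + v\<^sub>n\<^sub>-\<^sub>2) / det (v\<^sub>n\<^sub>-\<^sub>2, v\<^sub>0)\<close>, is forced.\<close>

section \<open>Plane determinants, polygons and their quiddities\<close>

definition det2 :: "'a::comm_ring_1 \<times> 'a \<Rightarrow> 'a \<times> 'a \<Rightarrow> 'a" where
  "det2 x y = fst x * snd y - snd x * fst y"

definition vec_comb :: "'a::comm_ring_1 \<Rightarrow> 'a \<times> 'a \<Rightarrow> 'a \<Rightarrow> 'a \<times> 'a \<Rightarrow> 'a \<times> 'a" where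
  "vec_comb s x t y = (s * fst x + t * fst y, s * snd x + t * snd y)"

lemma det2_comb_right: "det2 z (vec_comb s x t y) = s * det2 z x + t * det2 z y"
  by (simp add: det2_def vec_comb_def algebra_simps)

lemma det2_commute: "det2 x y = - det2 y x"
  by (simp add: det2_def algebra_simps)

lemma det2_self [simp]: "det2 x x = 0"
  by (simp add: det2_def algebra_simps)

lemma det2_swap: "det2 (prod.swap x) (prod.swap y) = det2 y x"
  by (simp add: det2_def algebra_simps)

text \<open>Any three plane vectors satisfy \<open>det2 x z\<close> y = \<open>det2 x y\<close> z +
  \<open>det2 y z\<close> x, and here both coefficients on the right are 1.\<close>

lemma det2_three_term:
  assumes "det2 x y = 1" "det2 y z = 1"
  shows "fst z = det2 x z * fst y - fst x" "snd z = det2 x z * snd y - snd x"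
proof -
  have "det2 x z * fst y = det2 x y * fst z + det2 y z * fst x"
       "det2 x z * snd y = det2 x y * snd z + det2 y z * snd x"
    by (simp_all add: det2_def algebra_simps)
  then show "fst z = det2 x z * fst y - fst x" "snd z = det2 x z * snd y - snd x"
    using assms by simp_all
qed

text \<open>Indexing by all integers with period \<open>n\<close> lets cyclic windows, shifts and
  reflections be written without \<open>mod\<close>; the offsets 2 to \<open>n - 2\<close> are
  exactly those of non-adjacent vertices.\<close>

definition polygon :: "nat \<Rightarrow> (int \<Rightarrow> 'a::comm_ring_1 \<times> 'a) \<Rightarrow> bool" where
  "polygon n v \<longleftrightarrow> (\<forall>i. v (i + int n) = v i) \<and> (\<forall>i. det2 (v i) (v (i + 1)) = 1) \<and>
     (\<forall>i d. 2 \<le> d \<longrightarrow> d \<le> int n - 2 \<longrightarrow> det2 (v i) (v (i + d)) \<notin> {1, -1})"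

definition quid_window :: "(int \<Rightarrow> 'a::comm_ring_1 \<times> 'a) \<Rightarrow> int \<Rightarrow> nat \<Rightarrow> 'a list" where
  "quid_window v i w = map (\<lambda>j. det2 (v (i + int j)) (v (i + int j + 2))) [0..<w]"

lemma length_quid_window [simp]: "length (quid_window v i w) = w"
  by (simp add: quid_window_def)

lemma nth_quid_window:
  "j < w \<Longrightarrow> quid_window v i w ! j = det2 (v (i + int j)) (v (i + int j + 2))"
  by (simp add: quid_window_def)

definition stack_mat :: "'a::comm_ring_1 \<times> 'a \<Rightarrow> 'a \<times> 'a \<Rightarrow> 'a^2^2" where
  "stack_mat x y = vector [vector [fst x, snd x], vector [fst y, snd y]]"

lemma quid_mat_append: "quid_mat (xs @ ys) = quid_mat ys ** quid_mat xs"
  by (induction xs) (simp_all add: matrix_mul_assoc)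

text \<open>With the newer vector stacked on top, each factor \<open>elem_mat\<close> moves a
  consecutive pair one step forward: the three-term recurrence in matrix form.\<close>

lemma quid_mat_window:
  assumes "\<And>i. det2 (v i) (v (i + 1)) = 1"
  shows "quid_mat (quid_window v i w) ** stack_mat (v (i + 1)) (v i) =
           stack_mat (v (i + int w + 1)) (v (i + int w))"
proof (induction w)
  case 0
  then show ?case by (simp add: quid_window_def)
next
  case (Suc w)
  define x y z where "x = v (i + int w)" and "y = v (i + int w + 1)" and "z = v (i + int w + 2)"
  have "det2 x y = 1" "det2 y z = 1"
    using assms[of "i + int w"] assms[of "i + int w + 1"] by (simp_all add: x_def y_def z_def add.assoc)
  note * = det2_three_term[OF this]
  have "elem_mat (det2 x z) ** stack_mat y x = stack_mat z y"
    using * by (simp add: elem_mat_def stack_mat_def vec_eq_iff forall_2 matrix_matrix_mult_def sum_2)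
  moreover have "quid_window v i (Suc w) = quid_window v i w @ [det2 x z]"
    by (simp add: quid_window_def x_def z_def)
  ultimately show ?case
    using Suc.IH
    by (simp add: quid_mat_append x_def y_def z_def matrix_mul_assoc [symmetric] algebra_simps)
qed

lemma lambda_quiddity_quid_window:
  fixes v :: "int \<Rightarrow> 'a::field \<times> 'a"
  assumes "polygon n v"
  shows "lambda_quiddity (quid_window v i n)"
proof -
  define S where "S = stack_mat (v (i + 1)) (v i)"
  have step: "det2 (v j) (v (j + 1)) = 1" and per: "v (j + int n) = v j" for j
    using assms by (auto simp: polygon_def)
  \<comment> \<open>A full turn returns to the starting pair, whose stacked matrix has determinant
    -1 and can be cancelled.\<close>
  have fix_S: "quid_mat (quid_window v i n) ** S = S"
    using quid_mat_window[of v i n] step per[of i] per[of "i + 1"]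
    by (simp add: S_def algebra_simps)
  have "det S = - det2 (v i) (v (i + 1))"
    by (simp add: S_def stack_mat_def det_2 det2_def)
  then have "invertible S"
    using step[of i] by (simp add: invertible_det_nz)
  then obtain T where "S ** T = mat 1"
    by (auto simp: invertible_def)
  then have "quid_mat (quid_window v i n) = mat 1"
    using fix_S by (metis matrix_mul_assoc matrix_mul_rid)
  then show ?thesis
    by (simp add: lambda_quiddity_def)
qed

section \<open>Rotation and reversal of polygon quiddities\<close>

lemma polygon_shift:
  assumes "polygon n v"
  shows "polygon n (\<lambda>i. v (i + k))"
proof -
  have "i + d + k = i + k + d" for i d :: int by simp
  then show ?thesis
    using assms by (simp only: polygon_def) blast
qed

text \<open>Reversing the orientation changes the sign of all determinants; swapping the coordinates
  restores it.\<close>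

lemma polygon_reflect:
  assumes "polygon n v"
  shows "polygon n (\<lambda>i. prod.swap (v (k - i)))"
proof -
  have step: "det2 (v j) (v (j + 1)) = 1" and per: "v (j + int n) = v j"
    and far: "\<And>d. 2 \<le> d \<Longrightarrow> d \<le> int n - 2 \<Longrightarrow> det2 (v j) (v (j + d)) \<notin> {1, -1}" for j
    using assms by (auto simp: polygon_def)
  show ?thesis
    unfolding polygon_def det2_swap
  proof (intro conjI allI impI)
    fix i
    show "prod.swap (v (k - (i + int n))) = prod.swap (v (k - i))"
      using per[of "k - (i + int n)"] by simp
    show "det2 (v (k - (i + 1))) (v (k - i)) = 1"
      using step[of "k - (i + 1)"] by simp
    fix d assume "2 \<le> d" "d \<le> int n - 2"
    then show "det2 (v (k - (i + d))) (v (k - i)) \<notin> {1, -1}"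
      using far[of d "k - (i + d)"] by simp
  qed
qed

lemma rotate_quid_window:
  assumes "polygon n v"
  shows "rotate k (quid_window v i n) = quid_window (\<lambda>j. v (j + int k)) i n"
proof (rule nth_equalityI)
  fix j assume "j < length (rotate k (quid_window v i n))"
  then have j: "j < n" by simp
  have per: "v (x + int n * m) = v x" for x m
  proof (induction m rule: int_induct[where k = 0])
    case (step1 m)
    then show ?case
      using assms by (metis polygon_def add.assoc distrib_left mult.right_neutral)
  next
    case (step2 m)
    have "v (x + int n * (m - 1) + int n) = v (x + int n * (m - 1))"
      using assms by (simp add: polygon_def)
    with step2 show ?case by (simp add: algebra_simps)
  qed simp
  define r where "r = (k + j) mod n"
  have r: "int k + int j = int r + int n * int ((k + j) div n)"
    unfolding r_def by (metis mod_mult_div_eq of_nat_add of_nat_mult)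
  have "v (i + int j + c + int k) = v (i + int r + c)" for c
    using per[of "i + int r + c" "int ((k + j) div n)"] r by (simp add: algebra_simps)
  from this[of 0] this[of 2] have "v (i + int j + int k) = v (i + int r)"
    "v (i + int j + 2 + int k) = v (i + int r + 2)" by simp_all
  moreover have "r < n" using j by (simp add: r_def)
  ultimately show "rotate k (quid_window v i n) ! j = quid_window (\<lambda>j. v (j + int k)) i n ! j"
    using j by (simp add: nth_rotate nth_quid_window flip: r_def)
qed simp

text \<open>Reflecting about \<open>n + 1\<close> sends the index pair (j, j + 2) to (n + 1 - j, n -
  1 - j), the pair of entry n - 1 - j in opposite order; the swap compensates the order.\<close>

lemma rev_quid_window:
  "rev (quid_window v 0 n) = quid_window (\<lambda>i. prod.swap (v (int n + 1 - i))) 0 n"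
proof (rule nth_equalityI)
  fix j assume "j < length (rev (quid_window v 0 n))"
  then have "j < n" by simp
  then show "rev (quid_window v 0 n) ! j =
      quid_window (\<lambda>i. prod.swap (v (int n + 1 - i))) 0 n ! j"
    by (simp add: rev_nth nth_quid_window det2_swap of_nat_diff algebra_simps)
qed simp

text \<open>Equivalence is absorbed into the choice of polygon, so a reduction may be examined as an
  equality with \<open>tuple_oplus a b\<close>.\<close>

lemma tuple_equiv_quid_window:
  assumes "polygon n v" "tuple_equiv (quid_window v 0 n) d"
  obtains v' where "polygon n v'" "d = quid_window v' 0 n"
proof -
  obtain k where "d = rotate k (quid_window v 0 n) \<or> d = rotate k (rev (quid_window v 0 n))"
    using assms(2) by (auto simp: tuple_equiv_def)
  then show ?thesis
  proof
    assume "d = rotate k (quid_window v 0 n)"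
    then show ?thesis
      using that[OF polygon_shift[OF assms(1), of "int k"]]
      by (simp add: rotate_quid_window[OF assms(1)])
  next
    assume d: "d = rotate k (rev (quid_window v 0 n))"
    note p = polygon_reflect[OF assms(1), of "int n + 1"]
    show ?thesis
      using that[OF polygon_shift[OF p, of "int k"]] d
      by (simp add: rev_quid_window rotate_quid_window[OF p])
  qed
qed

section \<open>Continuants and irreducibility\<close>

text \<open>The second row of \<open>elem_mat y\<close> is (1, 0) and the second column of
  \<open>elem_mat x\<close> is (-1, 0), so the end entries drop out.\<close>

lemma quid_mat_inner_entry:
  assumes "quid_mat (x # B @ [y]) = mat \<epsilon>"
  shows "quid_mat B $ 1 $ 1 = - \<epsilon>"
proof -
  have "quid_mat (x # B @ [y]) $ 2 $ 2 = - (quid_mat B $ 1 $ 1)"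
    by (simp add: quid_mat_append elem_mat_def matrix_matrix_mult_def sum_2 mat_def)
  then show ?thesis
    using assms by (simp add: mat_def)
qed

text \<open>The top row of the window identity expresses the far vector through
  \<open>v (i + 1)\<close> and \<open>v i\<close>; taking \<open>det2\<close> with
  \<open>v i\<close> kills the second term.\<close>

lemma quid_window_continuant:
  assumes "\<And>i. det2 (v i) (v (i + 1)) = 1"
  shows "quid_mat (quid_window v i w) $ 1 $ 1 = det2 (v i) (v (i + int w + 1))"
proof -
  define Q where "Q = quid_mat (quid_window v i w)"
  have "(Q ** stack_mat (v (i + 1)) (v i)) $ 1 $ k =
      stack_mat (v (i + int w + 1)) (v (i + int w)) $ 1 $ k" for k
    using quid_mat_window[of v i w] assms unfolding Q_def by simp
  from this[of 1] this[of 2]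
  have "v (i + int w + 1) = vec_comb (Q $ 1 $ 1) (v (i + 1)) (Q $ 1 $ 2) (v i)"
    by (simp add: stack_mat_def matrix_matrix_mult_def sum_2 vec_comb_def prod_eq_iff)
  then show ?thesis
    using assms[of i] by (simp add: det2_comb_right Q_def)
qed

lemma irreducible_quid_window:
  fixes v :: "int \<Rightarrow> 'a::field \<times> 'a"
  assumes "polygon n v" "n \<ge> 3"
  shows "irreducible_quiddity (quid_window v 0 n)"
proof -
  have False
    if equiv: "tuple_equiv (quid_window v 0 n) (tuple_oplus a b)"
      and len: "length a \<ge> 3" "length b \<ge> 3" and b: "lambda_quiddity b" for a b
  proof -
    obtain v' where v': "polygon n v'" and d: "tuple_oplus a b = quid_window v' 0 n"
      using tuple_equiv_quid_window[OF assms(1) equiv] by metis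
    define B where "B = butlast (tl b)"
    have b_eq: "b = hd b # B @ [last b]"
      using len(2) unfolding B_def
      by (cases b) (auto simp: Suc_le_length_iff numeral_eq_Suc)
    obtain \<epsilon> where eps: "\<epsilon> \<in> {1, -1}" and "quid_mat b = mat \<epsilon>"
      using b by (auto simp: lambda_quiddity_def)
    then have entry: "quid_mat B $ 1 $ 1 = - \<epsilon>"
      using quid_mat_inner_entry b_eq by metis
    have "length (tuple_oplus a b) = length a + length B"
      using len by (simp add: tuple_oplus_def B_def)
    then have n: "n = length a + length B"
      using d by simp
    \<comment> \<open>Only the end entries of \<open>b\<close> are merged with \<open>a\<close>; the
      inner ones survive as the tail, a window of the polygon.\<close>
    have "B = drop (length a) (tuple_oplus a b)"
      using len by (cases a) (simp_all add: tuple_oplus_def B_def)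
    also have "\<dots> = quid_window v' (int (length a)) (length B)"
      unfolding d by (rule nth_equalityI) (auto simp: n nth_quid_window algebra_simps)
    finally have "B = quid_window v' (int (length a)) (length B)" .
    moreover have "det2 (v' i) (v' (i + 1)) = 1" for i
      using v' by (simp add: polygon_def)
    ultimately have "det2 (v' (int (length a))) (v' (int (length a) + int (length B) + 1)) = - \<epsilon>"
      using quid_window_continuant[of v' "int (length a)" "length B"] entry by simp
    then have "det2 (v' (int (length a))) (v' (int (length a) + (int (length B) + 1))) = - \<epsilon>"
      by (simp add: algebra_simps)
    \<comment> \<open>The offset \<open>length B + 1\<close> lies between 2 and \<open>n - 2\<close>
      because both tuples have size at least 3.\<close>
    moreover have "length B \<ge> 1"
      using len by (simp add: B_def)
    then have "det2 (v' (int (length a))) (v' (int (length a) + (int (length B) + 1))) \<notin> {1, -1}"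
      using v' n len unfolding polygon_def by auto
    ultimately show False
      using eps by auto
  qed
  then show ?thesis
    using assms lambda_quiddity_quid_window[OF assms(1)]
    by (auto simp: irreducible_quiddity_def reducible_quiddity_def)
qed

section \<open>Greedy construction of a generic path\<close>

lemma affine_avoid:
  fixes F :: "('a::field \<times> 'a) set"
  assumes "infinite (UNIV :: 'a set)" "finite F" "\<And>s t. (s, t) \<in> F \<Longrightarrow> s \<noteq> 0"
  obtains a where "\<And>s t. (s, t) \<in> F \<Longrightarrow> a * s + t \<noteq> 0"
proof -
  obtain a where a: "a \<notin> (\<lambda>(s, t). - t / s) ` F"
    using ex_new_if_finite[OF assms(1) finite_imageI[OF assms(2)]] by blast
  have "a * s + t \<noteq> 0" if "(s, t) \<in> F" for s t
  proof
    assume "a * s + t = 0"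
    then have "a = - t / s"
      using assms(3)[OF that] by (simp add: field_simps eq_neg_iff_add_eq_0)
    then show False
      using a that by force
  qed
  then show ?thesis
    using that by blast
qed

text \<open>The third and fourth conditions make the slopes of the affine functions nonzero in the
  next step; the last condition makes the forced closing vector admissible.\<close>

definition generic_path :: "nat \<Rightarrow> (nat \<Rightarrow> 'a::comm_ring_1 \<times> 'a) \<Rightarrow> bool" where
  "generic_path m u \<longleftrightarrow>
     (\<forall>i<m. det2 (u i) (u (Suc i)) = 1) \<and>
     (\<forall>i j. i + 2 \<le> j \<longrightarrow> j \<le> m \<longrightarrow> det2 (u i) (u j) \<notin> {1, -1}) \<and>
     (\<forall>i j. i < j \<longrightarrow> j \<le> m \<longrightarrow> det2 (u i) (u j) \<noteq> 0) \<and>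
     (\<forall>e\<in>{1, -1}. \<forall>i j. 0 < i \<longrightarrow> i < j \<longrightarrow> j \<le> m \<longrightarrow>
        det2 (u i) (u j) + e * det2 (u 0) (u j) \<noteq> 0) \<and>
     (\<forall>e\<in>{1, -1}. \<forall>i j. 0 < i \<longrightarrow> i < j \<longrightarrow> j \<le> m \<longrightarrow>
        det2 (u i) (u j) + e * det2 (u 0) (u j) + det2 (u i) (u 0) \<noteq> 0)"

lemma generic_path_extend:
  fixes u :: "nat \<Rightarrow> 'a::field \<times> 'a"
  assumes inf: "infinite (UNIV :: 'a set)" and u: "generic_path m u" and m: "m \<ge> 1"
  obtains w where "generic_path (Suc m) (u(Suc m := w))"
proof -
  define p where "p = u m"
  define q where "q = u (m - 1)"
  define s where "s = (\<lambda>e i. det2 (u i) p + e * det2 (u 0) p)"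
  define t where "t = (\<lambda>e i. - det2 (u i) q - e * det2 (u 0) q)"
  \<comment> \<open>Pairs of slope and intercept in the unknown \<open>a\<close>, one per forbidden
    equation. The first family stops before \<open>m\<close>, where the slope vanishes and the value
    1 is forced.\<close>
  define F where "F =
    (\<lambda>(c, i). (det2 (u i) p, - det2 (u i) q - c)) ` ({0, 1, -1} \<times> {..<m}) \<union>
    (\<lambda>(e, i). (s e i, t e i)) ` ({1, -1} \<times> {1..m}) \<union>
    (\<lambda>(e, i). (s e i, t e i + det2 (u i) (u 0))) ` ({1, -1} \<times> {1..m})"
  have nz: "det2 (u i) p \<noteq> 0" if "i < m" for i
    using u that by (auto simp: generic_path_def p_def)
  \<comment> \<open>For \<open>i = m\<close> the slope is \<open>e * det2 (u 0) p\<close>, nonzero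
    by the third condition; otherwise the fourth condition applies.\<close>
  have snz: "s e i \<noteq> 0" if "e \<in> {1, -1}" "i \<in> {1..m}" for e i
  proof (cases "i = m")
    case True
    then show ?thesis
      using that nz[of 0] m by (auto simp: s_def p_def)
  next
    case False
    then show ?thesis
      using u that unfolding s_def p_def generic_path_def by auto
  qed
  have "finite F" by (simp add: F_def)
  moreover have "x \<noteq> 0" if "(x, y) \<in> F" for x y
    using that nz snz unfolding F_def by fastforce
  ultimately obtain a where a: "\<And>x y. (x, y) \<in> F \<Longrightarrow> a * x + y \<noteq> 0"
    using affine_avoid[OF inf] by metis
  define w where "w = vec_comb a p (-1) q"
  have dw: "det2 z w = a * det2 z p - det2 z q" for z
    by (simp add: w_def det2_comb_right)
  have last: "det2 (u m) w = 1"
  proof -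
    have "det2 q p = 1"
      using u m unfolding generic_path_def p_def q_def by (cases m) auto
    then show ?thesis
      using det2_commute[of p q] by (simp add: dw flip: p_def)
  qed
  have A: "det2 (u i) w \<noteq> c" if "i < m" "c \<in> {0, 1, -1}" for i c
  proof -
    have "(det2 (u i) p, - det2 (u i) q - c) \<in> F"
      unfolding F_def using that by force
    from a[OF this] show ?thesis by (auto simp: dw)
  qed
  have B: "det2 (u i) w + e * det2 (u 0) w \<noteq> 0" if "1 \<le> i" "i \<le> m" "e \<in> {1, -1}" for i e
  proof -
    have "(s e i, t e i) \<in> F"
      unfolding F_def using that by force
    from a[OF this] show ?thesis by (simp add: dw s_def t_def algebra_simps)
  qed
  have C: "det2 (u i) w + e * det2 (u 0) w + det2 (u i) (u 0) \<noteq> 0"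
    if "1 \<le> i" "i \<le> m" "e \<in> {1, -1}" for i e
  proof -
    have "(s e i, t e i + det2 (u i) (u 0)) \<in> F"
      unfolding F_def using that by force
    from a[OF this] show ?thesis by (simp add: dw s_def t_def algebra_simps)
  qed
  have nz': "det2 (u i) w \<noteq> 0" if "i \<le> m" for i
    using last A[of i 0] that by (cases "i = m") auto
  have "generic_path (Suc m) (u(Suc m := w))"
    unfolding generic_path_def
  proof (intro conjI allI ballI impI)
    fix i assume "i < Suc m"
    then show "det2 ((u(Suc m := w)) i) ((u(Suc m := w)) (Suc i)) = 1"
      using u last by (cases "i = m") (auto simp: generic_path_def)
  next
    fix i j assume "i + 2 \<le> j" "j \<le> Suc m"
    then show "det2 ((u(Suc m := w)) i) ((u(Suc m := w)) j) \<notin> {1, -1}"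
      using u A[of i 1] A[of i "-1"] by (cases "j = Suc m") (auto simp: generic_path_def)
  next
    fix i j assume "i < j" "j \<le> Suc m"
    then show "det2 ((u(Suc m := w)) i) ((u(Suc m := w)) j) \<noteq> 0"
      using u nz'[of i] by (cases "j = Suc m") (auto simp: generic_path_def)
  next
    fix e :: 'a and i j assume "e \<in> {1, -1}" "0 < i" "i < j" "j \<le> Suc m"
    then show "det2 ((u(Suc m := w)) i) ((u(Suc m := w)) j) +
        e * det2 ((u(Suc m := w)) 0) ((u(Suc m := w)) j) \<noteq> 0"
      using u B[of i e] by (cases "j = Suc m") (auto simp: generic_path_def)
  next
    fix e :: 'a and i j assume "e \<in> {1, -1}" "0 < i" "i < j" "j \<le> Suc m"
    then show "det2 ((u(Suc m := w)) i) ((u(Suc m := w)) j) +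
        e * det2 ((u(Suc m := w)) 0) ((u(Suc m := w)) j) +
        det2 ((u(Suc m := w)) i) ((u(Suc m := w)) 0) \<noteq> 0"
      using u C[of i e] by (cases "j = Suc m") (auto simp: generic_path_def)
  qed
  then show ?thesis by (rule that)
qed

lemma generic_path_exists:
  assumes "infinite (UNIV :: 'a::field set)" "m \<ge> 1"
  shows "\<exists>u :: nat \<Rightarrow> 'a \<times> 'a. generic_path m u"
  using assms(2)
proof (induction m rule: dec_induct)
  case base
  have "generic_path 1 (\<lambda>i. if i = 0 then (1, 0) else (0, 1 :: 'a))"
    by (auto simp: generic_path_def det2_def)
  then show ?case by blast
next
  case (step m)
  then show ?case
    using generic_path_extend[OF assms(1)] by metis
qed

section \<open>Closing the path to a polygon\<close>

lemma polygon_close: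
  fixes u :: "nat \<Rightarrow> 'a::field \<times> 'a"
  assumes u: "generic_path m u" and m: "m \<ge> 1"
  obtains v :: "int \<Rightarrow> 'a \<times> 'a" where "polygon (m + 2) v"
proof -
  define D where "D = det2 (u m) (u 0)"
  have D: "D \<noteq> 0" "det2 (u 0) (u m) = - D"
    using u m det2_commute[of "u m" "u 0"] by (auto simp: generic_path_def D_def)
  \<comment> \<open>The only vector with \<open>det2\<close> equal to 1 both from \<open>u m\<close>
    and to \<open>u 0\<close>.\<close>
  define w where "w = u(Suc m := vec_comb (1 / D) (u 0) (1 / D) (u m))"
  have w: "w i = u i" if "i \<le> m" for i
    using that by (simp add: w_def)
  have dw: "det2 z (w (Suc m)) = (det2 z (u 0) + det2 z (u m)) / D" for z
    by (simp add: w_def det2_comb_right add_divide_distrib)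
  have step: "det2 (w i) (w (Suc i)) = 1" if "i < Suc m" for i
  proof (cases "i = m")
    case True
    then show ?thesis using D by (simp add: dw w flip: D_def)
  next
    case False
    then show ?thesis using u that by (simp add: w generic_path_def)
  qed
  have close: "det2 (w (Suc m)) (w 0) = 1"
    using D det2_commute[of "w (Suc m)" "w 0"] by (simp add: dw w)
  \<comment> \<open>The bound \<open>j - i \<le> m\<close> excludes just the pair (0, m + 1),
    adjacent across the closing edge.\<close>
  have far: "det2 (w i) (w j) \<notin> {1, -1}" if ij: "i + 2 \<le> j" "j \<le> m + 1" "j - i \<le> m" for i j
  proof (cases "j = Suc m")
    case False
    then show ?thesis using u that by (simp add: w generic_path_def)
  next
    case True
    then have i: "0 < i" "i < m" using ij by auto
    \<comment> \<open>Since \<open>det2 (u 0) (u m) = - D\<close>, the fifth condition at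
      \<open>j = m\<close> says that the numerator in \<open>dw\<close> is not
      \<plusminus>\<open>D\<close>.\<close>
    then have "det2 (u i) (u m) + e * det2 (u 0) (u m) + det2 (u i) (u 0) \<noteq> 0"
      if "e \<in> {1, -1}" for e
      using u that unfolding generic_path_def by blast
    from this[of 1] this[of "-1"]
    have "det2 (u i) (u 0) + det2 (u i) (u m) \<noteq> D" "det2 (u i) (u 0) + det2 (u i) (u m) \<noteq> - D"
      using D(2) by (auto simp: algebra_simps)
    then show ?thesis
      using i D(1) True by (simp add: dw w divide_eq_eq)
  qed
  define n where "n = int (m + 2)"
  define v where "v = (\<lambda>i. w (nat (i mod n)))"
  have n: "n \<ge> 3" "n = int m + 2" using m by (auto simp: n_def)
  have "polygon (m + 2) v"
    unfolding polygon_def n_def[symmetric]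
  proof (intro conjI allI impI)
    fix i
    show "v (i + n) = v i" by (simp add: v_def)
    define r where "r = nat (i mod n)"
    have r: "int r = i mod n" "int r < n" using n(1) by (simp_all add: r_def)
    have vi: "v i = w r" by (simp add: v_def r_def)
    have v_add: "v (i + d) = w s" if "int s = (int r + d) mod n" for d s
    proof -
      have "(i + d) mod n = int s" using that by (simp add: r(1) mod_add_left_eq)
      then show ?thesis by (simp add: v_def)
    qed
    show "det2 (v i) (v (i + 1)) = 1"
    proof (cases "r = Suc m")
      case True
      then have "int r + 1 = n" using n(2) by linarith
      then have "v (i + 1) = w 0" by (intro v_add) simp
      then show ?thesis using True close vi by simp
    next
      case False
      then have "r < Suc m" "int r + 1 < n" using r(2) n(2) by linarith+
      then have "v (i + 1) = w (Suc r)" by (intro v_add) simp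
      then show ?thesis using step[OF \<open>r < Suc m\<close>] vi by simp
    qed
    fix d assume d: "2 \<le> d" "d \<le> n - 2"
    show "det2 (v i) (v (i + d)) \<notin> {1, -1}"
    proof (cases "int r + d < n")
      case True
      define s where "s = r + nat d"
      have s: "int s = int r + d" using d(1) by (simp add: s_def)
      have "v (i + d) = w s" using True d(1) by (intro v_add) (simp add: s)
      moreover have "r + 2 \<le> s" "s \<le> m + 1" "s - r \<le> m"
        using s True d n(2) by linarith+
      ultimately show ?thesis using far[of r s] vi by simp
    next
      case False
      \<comment> \<open>The index wraps around to \<open>s < r\<close>; antisymmetry changes only
        the sign, and {1, -1} is closed under negation.\<close>
      define s where "s = nat (int r + d - n)"
      have s: "int s = int r + d - n" using False by (simp add: s_def)
      have "(int r + d) mod n = (int r + d - n) mod n" by simp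
      also have "\<dots> = int r + d - n"
        using False r(2) d(2) by (intro mod_pos_pos_trivial) linarith+
      finally have "v (i + d) = w s" using s by (intro v_add) linarith
      moreover have "s + 2 \<le> r" "r \<le> m + 1" "r - s \<le> m"
        using s r(2) d n(2) by linarith+
      then have "det2 (w s) (w r) \<notin> {1, -1}" by (rule far)
      ultimately show ?thesis
        by (auto simp: vi det2_commute[of "w r" "w s"] minus_equation_iff[of _ 1])
    qed
  qed
  then show ?thesis by (rule that)
qed

lemma irreducible_quiddity_exists:
  assumes "infinite (UNIV :: 'a::field set)" "n \<ge> 3"
  shows "\<exists>c :: 'a list. length c = n \<and> irreducible_quiddity c"
proof -
  \<comment> \<open>A path indexed 0 to \<open>n - 2\<close> has \<open>n - 1\<close> vectors; the
    closing vector is the last one.\<close>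
  have m: "n - 2 \<ge> 1" "n - 2 + 2 = n" using assms(2) by auto
  obtain u :: "nat \<Rightarrow> 'a \<times> 'a" where "generic_path (n - 2) u"
    using generic_path_exists[OF assms(1) m(1)] by blast
  from polygon_close[OF this m(1)] obtain v :: "int \<Rightarrow> 'a \<times> 'a" where "polygon n v"
    unfolding m(2) by blast
  then show ?thesis
    using irreducible_quid_window[OF _ assms(2)] length_quid_window by blast
qed

theorem theorem3p12:
  assumes "infinite (UNIV :: 'a::field set)"
  shows "(\<forall>n\<ge>3. odd n \<longrightarrow> (\<exists>c :: 'a list. length c = n \<and> irreducible_quiddity c))
         \<and> ell TYPE('a) = \<infinity>"
proof -
  let ?S = "{length c | c :: 'a list. irreducible_quiddity c}"
  have "n \<in> ?S" if "n \<ge> 3" for n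
    using irreducible_quiddity_exists[OF assms that] by blast
  then have "infinite ?S"
    unfolding infinite_nat_iff_unbounded_le by (meson max.cobounded1 max.cobounded2)
  then have "\<not> bdd_above ?S"
    by (simp only: bdd_above_nat not_False_eq_True)
  then show ?thesis
    using irreducible_quiddity_exists[OF assms] by (auto simp only: ell_def Let_def if_False)
qed

end
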